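(* Let $\mathcal H$ be a real Hilbert space, let $\mu\in\,]0,\infty[$, let $n\ge 1$ be an integer, $I=\{1,\dots,n\}$, and let $\lambda_i>0$ ($i\in I$) satisfy $\sum_{i\in I}\lambda_i=1$. For each $i\in I$ let $A_i:\mathcal H\rightrightarrows\mathcal H$ be maximally monotone, and write $\mathbf A=(A_1,\dots,A_n)$, $\boldsymbol\lambda=(\lambda_1,\dots,\lambda_n)$. Then $$\operatorname{ran}\mathcal R_\mu(\mathbf A,\boldsymbol\lambda)\simeq\sum_{i\in I}\lambda_i\operatorname{ran}A_i\qquad\text{and}\qquad \operatorname{dom}\mathcal R_\mu(\mathbf A,\boldsymbol\lambda)\simeq\sum_{i\in I}\lambda_i\operatorname{dom}A_i.$$
   Context: For $A:\mathcal H\rightrightarrows\mathcal H$: $\operatorname{dom}A=\{x\in\mathcal H: Ax\neq\varnothing\}$, $\operatorname{ran}A=\bigcup_{x\in\mathcal H}Ax$, and $A^{-1}$ is the set-valued mapping with $x\in A^{-1}u\Leftrightarrow u\in Ax$. Sums and scalar multiples of sets and of set-valued mappings are (pointwise) Minkowski operations; $\mathrm{Id}$ is the identity. The $\boldsymbol\lambda$-weighted resolvent average of $\mathbf A$ with parameter $\mu$ is the set-valued mapping $$\mathcal R_\mu(\mathbf A,\boldsymbol\lambda)=\Big(\sum_{i\in I}\lambda_i(A_i+\mu^{-1}\mathrm{Id})^{-1}\Big)^{-1}-\mu^{-1}\mathrm{Id}.$$ The relative interior $\operatorname{ri}C$ of a set $C\subseteq\mathcal H$ is the interior of $C$ when considered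 as a subset of its closed affine hull. Two subsets $C,D$ of $\mathcal H$ are nearly equal, written $C\simeq D$, if $\overline C=\overline D$ and $\operatorname{ri}C=\operatorname{ri}D$. *)

theory Defs
  imports "HOL-Analysis.Analysis"
begin

text \<open>
  A set-valued mapping on \<open>H\<close> is a function of type \<open>'a \<Rightarrow> 'a set\<close>.  On sets, \<open>+\<close> and
  \<open>\<Sum>\<close> are the Minkowski operations of \<open>HOL-Library.Set_Algebras\<close> and a scalar multiple is
  the image under \<open>(*\<^sub>R) c\<close>.  The operation \<open>-\<close> on sets is set difference, so \<open>A - c Id\<close>
  is written as the Minkowski sum of \<open>A\<close> and \<open>(- c) Id\<close>.
\<close>

type_synonym 'a svmap = "'a \<Rightarrow> 'a set"

definition svdom :: "'a svmap \<Rightarrow> 'a set" where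
  "svdom A = {x. A x \<noteq> {}}"

definition svran :: "'a svmap \<Rightarrow> 'a set" where
  "svran A = (\<Union>x. A x)"

definition svinv :: "'a svmap \<Rightarrow> 'a svmap" where
  "svinv A = (\<lambda>u. {x. u \<in> A x})"

definition svid :: "'a svmap" where
  "svid = (\<lambda>x. {x})"

definition svadd :: "'a::plus svmap \<Rightarrow> 'a svmap \<Rightarrow> 'a svmap" where
  "svadd A B = (\<lambda>x. A x + B x)"

definition svsum :: "('i \<Rightarrow> 'a::comm_monoid_add svmap) \<Rightarrow> 'i set \<Rightarrow> 'a svmap" where
  "svsum A I = (\<lambda>x. \<Sum>i\<in>I. A i x)"

definition svscale :: "real \<Rightarrow> 'a::real_vector svmap \<Rightarrow> 'a svmap" where
  "svscale c A = (\<lambda>x. (*\<^sub>R) c ` A x)"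

definition monotone_map :: "'a::real_inner svmap \<Rightarrow> bool" where
  "monotone_map A \<longleftrightarrow> (\<forall>x y. \<forall>u\<in>A x. \<forall>v\<in>A y. (x - y) \<bullet> (u - v) \<ge> 0)"

definition maximally_monotone :: "'a::real_inner svmap \<Rightarrow> bool" where
  "maximally_monotone A \<longleftrightarrow>
     monotone_map A \<and> (\<forall>B. monotone_map B \<and> (\<forall>x. A x \<subseteq> B x) \<longrightarrow> B = A)"

definition resolvent_average ::
  "real \<Rightarrow> 'i set \<Rightarrow> ('i \<Rightarrow> 'a::real_vector svmap) \<Rightarrow> ('i \<Rightarrow> real) \<Rightarrow> 'a svmap" where
  "resolvent_average \<mu> I A lam =
     svadd
       (svinv (svsum (\<lambda>i. svscale (lam i) (svinv (svadd (A i) (svscale (inverse \<mu>) svid)))) I))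
       (svscale (- inverse \<mu>) svid)"

text \<open>
  The library's \<open>rel_interior\<close> is taken in the affine hull, which need not be closed in
  infinite dimension; here the interior is taken in the closed affine hull, i.e. the smallest
  closed affine set containing \<open>C\<close>.
\<close>

definition closed_affine_hull :: "'a::real_normed_vector set \<Rightarrow> 'a set" where
  "closed_affine_hull C = (\<lambda>S. affine S \<and> closed S) hull C"

definition ri :: "'a::real_normed_vector set \<Rightarrow> 'a set" where
  "ri C = top_of_set (closed_affine_hull C) interior_of C"

definition nearly_equal :: "'a::real_normed_vector set \<Rightarrow> 'a set \<Rightarrow> bool"  (infix \<open>\<simeq>\<close> 50) where
  "C \<simeq> D \<longleftrightarrow> closure C = closure D \<and> ri C = ri D"

end

theory Submission
  imports Defs
begin

text \<open>
  Put \<open>c = 1 / \<mu>\<close> and \<open>T\<^sub>i = (A\<^sub>i + c Id)\<^sup>-\<^sup>1\<close>.  By Minty's theorem each \<open>T\<^sub>i\<close> is a single-valued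
  mapping with full domain.  Both \<open>T\<^sub>i\<close> and \<open>Id - c T\<^sub>i\<close> are cocoercive, with ranges \<open>dom A\<^sub>i\<close> and
  \<open>ran A\<^sub>i\<close>.  Writing \<open>J = \<Sum>\<^sub>i \<lambda>\<^sub>i T\<^sub>i\<close>, the resolvent average has domain \<open>ran J\<close> and range
  \<open>ran (Id - c J)\<close>, and \<open>Id - c J = \<Sum>\<^sub>i \<lambda>\<^sub>i (Id - c T\<^sub>i)\<close> because the weights add up to \<open>1\<close>.  Both
  claims are thus instances of one statement (\<open>range_sum_cocoercive_nearly_equal\<close>): the range of a
  finite sum of cocoercive mappings is nearly equal to the Minkowski sum of their ranges.

  That statement is proved as in the Brezis--Haraux theorem.  Let \<open>F\<close> be the sum, \<open>y\<close> a point of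
  the Minkowski sum \<open>D\<close> of the ranges, and \<open>\<epsilon> x\<^sub>\<epsilon> + F x\<^sub>\<epsilon> = y\<close>.  Cocoercivity makes \<open>F\<close>
  rectangular, so \<open>\<epsilon> \<parallel>x\<^sub>\<epsilon>\<parallel>\<^sup>2\<close> is bounded and \<open>F x\<^sub>\<epsilon>\<close> tends to \<open>y\<close>, whence \<open>D\<close> and \<open>ran F\<close> have
  the same closure.  If moreover \<open>y \<in> ri D\<close>, then \<open>x\<^sub>\<epsilon>\<close> is bounded by the uniform boundedness
  principle in the direction space of the closed affine hull of \<open>D\<close>; bounded solutions converge in
  norm as \<open>\<epsilon>\<close> tends to \<open>0\<close>, and their limit is mapped to \<open>y\<close>.  So \<open>ri D \<subseteq> ran F \<subseteq> D\<close>, and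
  with equal closures this gives \<open>ri D = ri (ran F)\<close>.

  Minty's theorem is obtained from the Fitzpatrick function \<open>F\<^sub>A\<close> of \<open>A\<close>: the minimiser of
  \<open>F\<^sub>A (x, u) + (\<parallel>x\<parallel>\<^sup>2 + \<parallel>u\<parallel>\<^sup>2) / 2\<close> exists by strong convexity, and its optimality condition shows
  \<open>0 \<in> x + A x\<close>.
\<close>

section \<open>Minimising a strongly convex functional over an epigraph\<close>

text \<open>
  A closed convex set \<open>S\<close> of pairs \<open>(p, r)\<close> plays the role of the epigraph of a proper lower
  semicontinuous convex function \<open>F\<close>.  The lemma says that \<open>F + \<parallel>\<cdot>\<parallel>\<^sup>2 / 2\<close> attains its infimum
  as soon as it is bounded below (the parallelogram identity makes minimising sequences
  Cauchy), and that the minimiser \<open>p\<close> satisfies \<open>- p \<in> \<partial>F p\<close>.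
\<close>

lemma epigraph_minimiser:
  fixes S :: "('h::{real_inner, complete_space} \<times> real) set"
  assumes cl: "closed S" and cv: "convex S" and ne: "S \<noteq> {}"
    and bd: "\<And>p r. (p, r) \<in> S \<Longrightarrow> 0 \<le> r + (norm p)\<^sup>2 / 2"
  obtains p r where "(p, r) \<in> S" and "\<And>q s. (q, s) \<in> S \<Longrightarrow> r \<le> s + p \<bullet> (q - p)"
proof -
  define g where "g = (\<lambda>(p::'h, r::real). r + (norm p)\<^sup>2 / 2)"
  define m where "m = Inf (g ` S)"
  have bb: "bdd_below (g ` S)"
    using bd by (auto simp: g_def intro!: bdd_belowI[of _ 0])
  have m_le: "m \<le> s + (norm q)\<^sup>2 / 2" if "(q, s) \<in> S" for q s
    using cINF_lower[OF bb that] by (simp add: m_def g_def)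
  have "\<exists>z\<in>S. g z < m + inverse (real (Suc k))" for k
    using cInf_lessD[of "g ` S" "m + inverse (real (Suc k))"] ne unfolding m_def by auto
  then obtain z where z: "\<And>k. z k \<in> S" "\<And>k. g (z k) < m + inverse (real (Suc k))"
    by metis
  define P where "P k = fst (z k)" for k
  define R where "R k = snd (z k)" for k
  have PR: "(P k, R k) \<in> S" for k
    using z(1)[of k] by (simp add: P_def R_def)
  have up: "R k + (norm (P k))\<^sup>2 / 2 < m + inverse (real (Suc k))" for k
    using z(2)[of k] by (simp add: P_def R_def g_def case_prod_beta)
  have gap: "(norm (P k - P l))\<^sup>2 \<le> 4 * (inverse (real (Suc k)) + inverse (real (Suc l)))" for k l
  proof -
    have "((1/2) *\<^sub>R P k + (1/2) *\<^sub>R P l, (1/2) * R k + (1/2) * R l) \<in> S"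
      using convexD[OF cv PR[of k] PR[of l], of "1/2" "1/2"] by simp
    from m_le[OF this]
    have "m \<le> R k / 2 + R l / 2 + (norm ((1/2) *\<^sub>R P k + (1/2) *\<^sub>R P l))\<^sup>2 / 2"
      by simp
    moreover have "(norm ((1/2) *\<^sub>R P k + (1/2) *\<^sub>R P l))\<^sup>2
        = (norm (P k))\<^sup>2 / 2 + (norm (P l))\<^sup>2 / 2 - (norm (P k - P l))\<^sup>2 / 4"
      by (simp add: power2_norm_eq_inner algebra_simps inner_commute diff_divide_distrib add_divide_distrib)
    ultimately show ?thesis using up[of k] up[of l]
      by (simp only: diff_divide_distrib add_divide_distrib divide_divide_eq_left) argo
  qed
  have "Cauchy P"
  proof (rule metric_CauchyI)
    fix e :: real assume "0 < e"
    then have "0 < e\<^sup>2 / 8" by simp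
    then obtain N where N: "inverse (real (Suc N)) < e\<^sup>2 / 8"
      using reals_Archimedean by blast
    have "dist (P k) (P l) < e" if "N \<le> k" "N \<le> l" for k l
    proof -
      have "inverse (real (Suc k)) \<le> inverse (real (Suc N))"
        "inverse (real (Suc l)) \<le> inverse (real (Suc N))"
        using that by (auto intro: le_imp_inverse_le)
      then have "(norm (P k - P l))\<^sup>2 < e\<^sup>2"
        using gap[of k l] N by argo
      then show ?thesis
        using \<open>0 < e\<close> by (simp add: dist_norm power_less_imp_less_base)
    qed
    then show "\<exists>M. \<forall>k\<ge>M. \<forall>l\<ge>M. dist (P k) (P l) < e" by blast
  qed
  then obtain p where p: "P \<longlonglongrightarrow> p"
    using Cauchy_convergent convergent_def by blast
  have "(\<lambda>k. R k + (norm (P k))\<^sup>2 / 2) \<longlonglongrightarrow> m"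
  proof (rule tendsto_sandwich)
    show "\<forall>\<^sub>F k in sequentially. m \<le> R k + (norm (P k))\<^sup>2 / 2"
      using m_le[OF PR] by simp
    show "\<forall>\<^sub>F k in sequentially. R k + (norm (P k))\<^sup>2 / 2 \<le> m + inverse (real (Suc k))"
      using up by (simp add: less_imp_le)
    show "(\<lambda>k. m + inverse (real (Suc k))) \<longlonglongrightarrow> m"
      by (rule LIMSEQ_inverse_real_of_nat_add)
  qed simp
  moreover have nP: "(\<lambda>k. (norm (P k))\<^sup>2 / 2) \<longlonglongrightarrow> (norm p)\<^sup>2 / 2"
    using p by (intro tendsto_intros) auto
  ultimately have "R \<longlonglongrightarrow> m - (norm p)\<^sup>2 / 2"
    using tendsto_diff by fastforce
  define r where "r = m - (norm p)\<^sup>2 / 2"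
  have pr: "(p, r) \<in> S"
    using closed_sequentially[OF cl PR tendsto_Pair[OF p \<open>R \<longlonglongrightarrow> _\<close>]] by (simp add: r_def)
  moreover have "r \<le> s + p \<bullet> (q - p)" if qs: "(q, s) \<in> S" for q s
  proof -
    \<comment> \<open>Compare the minimiser with the point at parameter \<open>t\<close> of the segment, divide by \<open>t\<close>, let \<open>t\<close> tend to \<open>0\<close>.\<close>
    have step: "0 \<le> (s - r + p \<bullet> (q - p)) + t * ((norm (q - p))\<^sup>2 / 2)" if t: "0 < t" "t < 1" for t
    proof -
      have "((1 - t) *\<^sub>R p + t *\<^sub>R q, (1 - t) * r + t * s) \<in> S"
        using convexD[OF cv pr qs, of "1 - t" t] t by simp
      from m_le[OF this]
      have "r + (norm p)\<^sup>2 / 2 \<le> (1 - t) * r + t * s + (norm ((1 - t) *\<^sub>R p + t *\<^sub>R q))\<^sup>2 / 2"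
        by (simp add: r_def)
      moreover have "(norm ((1 - t) *\<^sub>R p + t *\<^sub>R q))\<^sup>2
          = (norm p)\<^sup>2 + 2 * t * (p \<bullet> (q - p)) + t\<^sup>2 * (norm (q - p))\<^sup>2"
      proof -
        have eq: "(1 - t) *\<^sub>R p + t *\<^sub>R q = p + t *\<^sub>R (q - p)" by (simp add: algebra_simps)
        show ?thesis unfolding eq power2_norm_eq_inner
          by (simp add: inner_add_left inner_add_right inner_commute power2_eq_square)
      qed
      ultimately have "0 \<le> t * ((s - r + p \<bullet> (q - p)) + t * ((norm (q - p))\<^sup>2 / 2))"
        by (simp add: algebra_simps power2_eq_square)
      then show ?thesis using t by (simp add: zero_le_mult_iff)
    qed
    have "((\<lambda>t. (s - r + p \<bullet> (q - p)) + t * ((norm (q - p))\<^sup>2 / 2))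
        \<longlongrightarrow> (s - r + p \<bullet> (q - p)) + 0 * ((norm (q - p))\<^sup>2 / 2)) (at_right 0)"
      by (intro tendsto_intros)
    moreover have "\<forall>\<^sub>F t in at_right (0::real). 0 \<le> (s - r + p \<bullet> (q - p)) + t * ((norm (q - p))\<^sup>2 / 2)"
      using step eventually_at_right_less[of "0::real"] unfolding eventually_at_right_field
      by (meson zero_less_one)
    ultimately have "0 \<le> (s - r + p \<bullet> (q - p)) + 0 * ((norm (q - p))\<^sup>2 / 2)"
      by (rule tendsto_lowerbound) simp
    then show ?thesis by simp
  qed
  ultimately show thesis using that by blast
qed

section \<open>Surjectivity of monotone mappings perturbed by the identity\<close>

lemma maximally_monotoneD:
  assumes "maximally_monotone A"
  shows "monotone_map A"
    and "\<And>x u. (\<And>a b. b \<in> A a \<Longrightarrow> 0 \<le> (x - a) \<bullet> (u - b)) \<Longrightarrow> u \<in> A x"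
proof -
  show mono: "monotone_map A" using assms by (simp add: maximally_monotone_def)
  fix x u assume rel: "\<And>a b. b \<in> A a \<Longrightarrow> 0 \<le> (x - a) \<bullet> (u - b)"
  define B where "B = A(x := insert u (A x))"
  have "monotone_map B"
    unfolding monotone_map_def
  proof (intro allI ballI)
    fix y z v w assume "v \<in> B y" "w \<in> B z"
    then have v: "v \<in> A y \<or> y = x \<and> v = u" and w: "w \<in> A z \<or> z = x \<and> w = u"
      by (auto simp: B_def split: if_splits)
    have "0 \<le> (y - x) \<bullet> (v - u)" if "v \<in> A y"
      using rel[OF that] by (simp add: algebra_simps)
    then show "0 \<le> (y - z) \<bullet> (v - w)"
      using v w rel[of w z] mono by (auto simp: monotone_map_def)
  qed
  moreover have "\<forall>y. A y \<subseteq> B y" by (auto simp: B_def)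
  ultimately have "B = A" using assms by (simp add: maximally_monotone_def)
  then have "B x = A x" by simp
  then show "u \<in> A x" by (auto simp: B_def)
qed

text \<open>
  Minty's theorem at the origin.  Maximality is assumed in the pointwise form: every pair that is
  monotonically related to the graph belongs to it.  The set \<open>S\<close> is the epigraph of the Fitzpatrick
  function \<open>F (x, u) = sup {x \<bullet> b + a \<bullet> u - a \<bullet> b | b \<in> A a}\<close>, which dominates \<open>x \<bullet> u\<close> and
  agrees with it on the graph.
\<close>

lemma minty_zero:
  fixes A :: "'a::{real_inner, complete_space} svmap"
  assumes mono: "monotone_map A"
    and maxi: "\<And>x u. (\<And>a b. b \<in> A a \<Longrightarrow> 0 \<le> (x - a) \<bullet> (u - b)) \<Longrightarrow> u \<in> A x"
  shows "\<exists>x. - x \<in> A x"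
proof -
  define S :: "(('a \<times> 'a) \<times> real) set"
    where "S = {((x, u), r) |x u r. \<forall>a b. b \<in> A a \<longrightarrow> x \<bullet> b + a \<bullet> u - a \<bullet> b \<le> r}"
  have S_iff: "((x, u), r) \<in> S \<longleftrightarrow> (\<forall>a b. b \<in> A a \<longrightarrow> x \<bullet> b + a \<bullet> u - a \<bullet> b \<le> r)" for x u r
    by (simp add: S_def)
  have S_alt: "S = (\<Inter>(a, b)\<in>{(a, b). b \<in> A a}. {z. ((b, a), -1) \<bullet> z \<le> a \<bullet> b})"
  proof -
    have "x \<bullet> b + a \<bullet> u - a \<bullet> b \<le> r \<longleftrightarrow> ((b, a), -1) \<bullet> ((x, u), r) \<le> a \<bullet> b" for x u a b :: 'a and r
      by (simp add: inner_prod_def inner_commute[of x b] algebra_simps)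
    then show ?thesis unfolding S_def by auto
  qed
  have cl: "closed S"
    unfolding S_alt by (intro closed_INT ballI) (auto intro!: closed_Collect_le continuous_intros)
  have cv: "convex S"
    unfolding S_alt by (intro convex_INT) (auto simp: convex_halfspace_le)
  have graph: "((a, b), a \<bullet> b) \<in> S" if "b \<in> A a" for a b
  proof -
    have "0 \<le> (a - c) \<bullet> (b - d)" if "d \<in> A c" for c d
      using mono \<open>b \<in> A a\<close> that by (auto simp: monotone_map_def)
    then show ?thesis unfolding S_iff by (auto simp: algebra_simps)
  qed
  have ne: "S \<noteq> {}"
  proof (cases "\<exists>a b. b \<in> A a")
    case True then show ?thesis using graph by blast
  next
    case False then show ?thesis using maxi by blast
  qed
  have ge: "x \<bullet> u \<le> r" if "((x, u), r) \<in> S" for x u r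
  proof (cases "u \<in> A x")
    case True then show ?thesis using that by (force simp: S_iff)
  next
    case False
    then obtain a b where "b \<in> A a" "(x - a) \<bullet> (u - b) < 0"
      using maxi by (meson not_le)
    then show ?thesis using that unfolding S_iff by (force simp: algebra_simps)
  qed
  have bd: "0 \<le> r + (norm p)\<^sup>2 / 2" if "(p, r) \<in> S" for p r
  proof -
    obtain x u where p: "p = (x, u)" by force
    have eq: "(x + u) \<bullet> (x + u) = 2 * (x \<bullet> u + (x \<bullet> x + u \<bullet> u) / 2)"
      by (simp add: algebra_simps inner_commute)
    have "0 \<le> 2 * (x \<bullet> u + (x \<bullet> x + u \<bullet> u) / 2)"
      using inner_ge_zero[of "x + u"] unfolding eq .
    then have "0 \<le> x \<bullet> u + (x \<bullet> x + u \<bullet> u) / 2" by (simp only: zero_le_mult_iff) simp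
    also have "\<dots> = x \<bullet> u + (norm p)\<^sup>2 / 2"
      unfolding p power2_norm_eq_inner by simp
    also have "\<dots> \<le> r + (norm p)\<^sup>2 / 2" using ge that p by simp
    finally show ?thesis .
  qed
  obtain p r where pr: "(p, r) \<in> S" and opt: "\<And>q s. (q, s) \<in> S \<Longrightarrow> r \<le> s + p \<bullet> (q - p)"
    by (rule epigraph_minimiser[OF cl cv ne bd]) auto
  obtain x u where p: "p = (x, u)" by force
  have xu: "x \<bullet> u \<le> r" using ge pr p by simp
  have rel: "(x + u) \<bullet> (x + u) \<le> (- u - a) \<bullet> (- x - b)" if "b \<in> A a" for a b
    using opt[OF graph[OF that]] xu by (simp add: p algebra_simps inner_commute)
  then have "0 \<le> (- u - a) \<bullet> (- x - b)" if "b \<in> A a" for a b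
    using that inner_ge_zero[of "x + u"] by (meson order_trans)
  then have mem: "- x \<in> A (- u)" by (rule maxi)
  \<comment> \<open>Testing the strong form of the inequality at the pair just found forces \<open>u = - x\<close>.\<close>
  have "(x + u) \<bullet> (x + u) \<le> 0" using rel[OF mem] by simp
  then have "x + u = 0" by (metis inner_ge_zero inner_eq_zero_iff order_antisym)
  then have "- u = x" by (metis add.commute add_eq_0_iff)
  then show ?thesis using mem by auto
qed

text \<open>Minty's theorem: \<open>A + c Id\<close> is surjective.\<close>

lemma minty:
  fixes A :: "'a::{real_inner, complete_space} svmap"
  assumes mono: "monotone_map A"
    and maxi: "\<And>x u. (\<And>a b. b \<in> A a \<Longrightarrow> 0 \<le> (x - a) \<bullet> (u - b)) \<Longrightarrow> u \<in> A x"
    and c: "c > 0"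
  shows "\<exists>x. z - c *\<^sub>R x \<in> A x"
proof -
  \<comment> \<open>\<open>B = (A - z) / c\<close> satisfies the same hypotheses, and its zero of \<open>Id + B\<close> is the point sought.\<close>
  define B where "B x = {b. c *\<^sub>R b + z \<in> A x}" for x
  have "\<exists>x. - x \<in> B x"
  proof (rule minty_zero)
    show "monotone_map B"
      unfolding monotone_map_def
    proof (intro allI ballI)
      fix x y u v assume "u \<in> B x" "v \<in> B y"
      then have "0 \<le> (x - y) \<bullet> ((c *\<^sub>R u + z) - (c *\<^sub>R v + z))"
        using mono unfolding monotone_map_def B_def by blast
      also have "\<dots> = c * ((x - y) \<bullet> (u - v))" by (simp add: algebra_simps)
      finally show "0 \<le> (x - y) \<bullet> (u - v)" using c by (simp add: zero_le_mult_iff)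
    qed
  next
    fix x u assume rel: "\<And>a b. b \<in> B a \<Longrightarrow> 0 \<le> (x - a) \<bullet> (u - b)"
    have "c *\<^sub>R u + z \<in> A x"
    proof (rule maxi)
      fix a b assume b: "b \<in> A a"
      define d where "d = (1 / c) *\<^sub>R (b - z)"
      have bd: "c *\<^sub>R d + z = b" using c by (simp add: d_def)
      then have "0 \<le> (x - a) \<bullet> (u - d)" using rel b by (simp add: B_def)
      then have "0 \<le> c * ((x - a) \<bullet> (u - d))" using c by simp
      also have "\<dots> = (x - a) \<bullet> (c *\<^sub>R u + z - (c *\<^sub>R d + z))" by (simp add: algebra_simps)
      finally show "0 \<le> (x - a) \<bullet> (c *\<^sub>R u + z - b)" by (simp add: bd)
    qed
    then show "u \<in> B x" by (simp add: B_def)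
  qed
  then show ?thesis by (auto simp: B_def algebra_simps)
qed

text \<open>A continuous monotone mapping with full domain is maximal, so Minty's theorem applies to it.\<close>

lemma continuous_monotone_regularised_surj:
  fixes F :: "'a::{real_inner, complete_space} \<Rightarrow> 'a"
  assumes mono: "\<And>x y. 0 \<le> (x - y) \<bullet> (F x - F y)"
    and cont: "continuous_on UNIV F" and e: "e > 0"
  shows "\<exists>x. e *\<^sub>R x + F x = y"
proof -
  have "\<exists>x. y - e *\<^sub>R x \<in> {F x}"
  proof (rule minty[OF _ _ e])
    show "monotone_map (\<lambda>x. {F x})" using mono by (simp add: monotone_map_def)
  next
    fix x u assume rel: "\<And>a b. b \<in> {F a} \<Longrightarrow> 0 \<le> (x - a) \<bullet> (u - b)"
    \<comment> \<open>Approach \<open>x\<close> along the ray in the direction \<open>h = F x - u\<close>.\<close>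
    define h where "h = F x - u"
    have le: "0 \<le> h \<bullet> (u - F (x - t *\<^sub>R h))" if "t > 0" for t
      using rel[of "F (x - t *\<^sub>R h)" "x - t *\<^sub>R h"] that by (simp add: zero_le_mult_iff)
    have "isCont F x" using cont by (simp add: continuous_on_eq_continuous_at)
    moreover have "((\<lambda>t. x - t *\<^sub>R h) \<longlongrightarrow> x - 0 *\<^sub>R h) (at_right 0)" by (intro tendsto_intros)
    ultimately have "((\<lambda>t. F (x - t *\<^sub>R h)) \<longlongrightarrow> F x) (at_right 0)"
      using isCont_tendsto_compose[of x F] by simp
    then have "((\<lambda>t. h \<bullet> (u - F (x - t *\<^sub>R h))) \<longlongrightarrow> h \<bullet> (u - F x)) (at_right 0)"
      by (intro tendsto_intros)
    moreover have "\<forall>\<^sub>F t in at_right (0::real). 0 \<le> h \<bullet> (u - F (x - t *\<^sub>R h))"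
      using eventually_at_right_less[of "0::real"] by eventually_elim (rule le)
    ultimately have "0 \<le> h \<bullet> (u - F x)" by (rule tendsto_lowerbound) simp
    then have "h \<bullet> h \<le> 0" by (simp add: h_def algebra_simps)
    then have "h = 0" by (metis inner_ge_zero inner_eq_zero_iff order_antisym)
    then show "u \<in> {F x}" by (simp add: h_def)
  qed
  then show ?thesis by (metis add.commute diff_add_cancel singletonD)
qed

section \<open>Uniform boundedness on a closed subspace\<close>

text \<open>A form of the Banach--Steinhaus theorem, obtained from Baire's theorem in \<open>L\<close>.\<close>

lemma pointwise_bounded_above_imp_norm_bounded:
  fixes L X :: "'a::{real_inner, complete_space} set"
  assumes L: "closed L" "subspace L" and X: "X \<subseteq> L"
    and pw: "\<And>h. h \<in> L \<Longrightarrow> \<exists>K. \<forall>x\<in>X. x \<bullet> h \<le> K"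
  shows "\<exists>C. \<forall>x\<in>X. norm x \<le> C"
proof -
  define E where "E m = {h\<in>L. \<forall>x\<in>X. x \<bullet> h \<le> real m}" for m :: nat
  have E_closed: "closedin (top_of_set L) (E m)" for m
  proof -
    have "E m = L \<inter> (\<Inter>x\<in>X. {h. x \<bullet> h \<le> real m})" by (auto simp: E_def)
    moreover have "closed (\<Inter>x\<in>X. {h. x \<bullet> h \<le> real m})"
      by (intro closed_INT ballI closed_halfspace_le)
    ultimately show ?thesis by (simp add: closedin_closed_Int)
  qed
  have E_cover: "(\<Union>m. E m) = L"
  proof -
    have "h \<in> (\<Union>m. E m)" if h: "h \<in> L" for h
    proof -
      obtain K where "\<forall>x\<in>X. x \<bullet> h \<le> K" using pw[OF h] by blast
      moreover obtain m :: nat where "K \<le> real m" using real_arch_simple by blast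
      ultimately have "h \<in> E m" using h by (auto simp: E_def intro: order_trans)
      then show ?thesis by blast
    qed
    then show ?thesis by (auto simp: E_def)
  qed
  have "\<exists>m. top_of_set L interior_of E m \<noteq> {}"
  proof (rule ccontr)
    assume "\<not> ?thesis"
    moreover have "completely_metrizable_space (top_of_set L)"
      using L(1) by (simp add: completely_metrizable_space_closedin completely_metrizable_space_euclidean)
    ultimately have "top_of_set L interior_of (\<Union>(range E)) = {}"
      by (intro Baire_category_alt) (use E_closed in auto)
    then have "L = {}" using E_cover by (metis interior_of_topspace topspace_euclidean_subtopology)
    then show False using L(2) subspace_0 by blast
  qed
  then obtain m h where "h \<in> top_of_set L interior_of E m" by blast
  then obtain T where T: "openin (top_of_set L) T" "h \<in> T" "T \<subseteq> E m"
    by (auto simp: interior_of_def)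
  then obtain e where e: "e > 0" "ball h e \<inter> L \<subseteq> E m" and hL: "h \<in> L"
    unfolding openin_contains_ball by blast
  obtain K where K: "\<forall>x\<in>X. x \<bullet> (- h) \<le> K"
    using pw[of "- h"] hL L(2) subspace_neg by blast
  have "norm x \<le> 2 * (real m + K) / e" if x: "x \<in> X" "x \<noteq> 0" for x
  proof -
    define w where "w = h + (e / (2 * norm x)) *\<^sub>R x"
    have "w \<in> L" using hL X x L(2) by (auto simp: w_def subspace_add subspace_scale)
    moreover have "w \<in> ball h e" using e x by (simp add: w_def dist_norm)
    ultimately have "x \<bullet> w \<le> real m" using e x by (auto simp: E_def)
    moreover have "x \<bullet> w = x \<bullet> h + e / 2 * norm x"
      using x by (simp add: w_def inner_add_right dot_square_norm power2_eq_square)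
    ultimately show ?thesis using K x e by (force simp: field_simps)
  qed
  then have "\<forall>x\<in>X. norm x \<le> max 0 (2 * (real m + K) / e)" by fastforce
  then show ?thesis by blast
qed

section \<open>Cocoercive mappings\<close>

text \<open>A \<open>c\<close>-cocoercive mapping; for \<open>c = 1\<close> these are the firmly nonexpansive mappings.\<close>

definition cocoercive :: "real \<Rightarrow> ('a::real_inner \<Rightarrow> 'a) \<Rightarrow> bool" where
  "cocoercive c T \<longleftrightarrow> (\<forall>x y. c * (norm (T x - T y))\<^sup>2 \<le> (x - y) \<bullet> (T x - T y))"

lemma cocoercive_monotone:
  assumes "cocoercive c T" "c > 0"
  shows "0 \<le> (x - y) \<bullet> (T x - T y)"
proof -
  have "0 \<le> c * (norm (T x - T y))\<^sup>2" using assms(2) by simp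
  also have "\<dots> \<le> (x - y) \<bullet> (T x - T y)" using assms(1) unfolding cocoercive_def by blast
  finally show ?thesis .
qed

lemma cocoercive_scaleR:
  assumes "cocoercive c T" "l > 0"
  shows "cocoercive (c / l) (\<lambda>x. l *\<^sub>R T x)"
proof -
  have "c / l * (norm (l *\<^sub>R T x - l *\<^sub>R T y))\<^sup>2 \<le> (x - y) \<bullet> (l *\<^sub>R T x - l *\<^sub>R T y)" for x y
  proof -
    have eq: "l *\<^sub>R T x - l *\<^sub>R T y = l *\<^sub>R (T x - T y)" by (simp add: algebra_simps)
    have "c / l * (norm (l *\<^sub>R (T x - T y)))\<^sup>2 = l * (c * (norm (T x - T y))\<^sup>2)"
      using assms(2) by (simp add: power_mult_distrib power2_eq_square)
    also have "\<dots> \<le> l * ((x - y) \<bullet> (T x - T y))"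
      using assms unfolding cocoercive_def by (intro mult_left_mono) auto
    also have "\<dots> = (x - y) \<bullet> (l *\<^sub>R (T x - T y))" by (rule inner_scaleR_right[symmetric])
    finally show ?thesis unfolding eq .
  qed
  then show ?thesis by (simp add: cocoercive_def)
qed

lemma cocoercive_imp_lipschitz:
  assumes "cocoercive c T" "c > 0"
  shows "norm (T x - T y) \<le> norm (x - y) / c"
proof (cases "T x = T y")
  case False
  have "c * (norm (T x - T y))\<^sup>2 \<le> norm (x - y) * norm (T x - T y)"
    using assms norm_cauchy_schwarz order_trans unfolding cocoercive_def by blast
  then have "c * norm (T x - T y) \<le> norm (x - y)"
    using False by (simp add: power2_eq_square)
  then show ?thesis using assms(2) by (simp add: field_simps)
qed (use assms in simp)

lemma cocoercive_imp_continuous: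
  assumes "cocoercive c T" "c > 0"
  shows "continuous_on UNIV T"
proof -
  have "(1 / c)-lipschitz_on UNIV T"
    using cocoercive_imp_lipschitz[OF assms] assms(2)
    by (intro lipschitz_onI) (simp_all add: dist_norm)
  then show ?thesis by (rule lipschitz_on_continuous_on)
qed

text \<open>
  Rectangularity (3* monotonicity) at the origin: monotonicity alone bounds
  \<open>(x - w) \<bullet> (T x - T w)\<close> from below, and the quadratic term of cocoercivity absorbs the error
  \<open>w \<bullet> (T x - T w)\<close> made when \<open>x - w\<close> is replaced by \<open>x\<close>.
\<close>

lemma cocoercive_rectangular:
  assumes "cocoercive c T" "c > 0"
  shows "- ((norm w)\<^sup>2 / (4 * c)) \<le> x \<bullet> (T x - T w)"
proof -
  define d where "d = T x - T w"
  have "0 \<le> (2 * c * norm d - norm w)\<^sup>2 / (4 * c)" using assms(2) by simp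
  also have "\<dots> = c * (norm d)\<^sup>2 - norm w * norm d + (norm w)\<^sup>2 / (4 * c)"
    using assms(2) by (simp add: field_simps power2_eq_square)
  also have "\<dots> \<le> (x - w) \<bullet> d + w \<bullet> d + (norm w)\<^sup>2 / (4 * c)"
  proof -
    have "c * (norm d)\<^sup>2 \<le> (x - w) \<bullet> d" using assms(1) by (simp add: cocoercive_def d_def)
    moreover have "- (norm w * norm d) \<le> w \<bullet> d"
      using Cauchy_Schwarz_ineq2[of w d] by linarith
    ultimately show ?thesis by linarith
  qed
  finally show ?thesis by (simp add: d_def algebra_simps)
qed

lemma set_sum_rangeE:
  assumes "finite I" "y \<in> (\<Sum>i\<in>I. range (f i))"
  obtains w where "y = (\<Sum>i\<in>I. f i (w i))"
proof -
  obtain s where s: "y = sum s I" "\<forall>i\<in>I. s i \<in> range (f i)"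
    using assms by (auto simp: set_sum_alt)
  then have "\<forall>i\<in>I. \<exists>w. s i = f i w" by blast
  then obtain w where "\<forall>i\<in>I. s i = f i (w i)" unfolding bchoice_iff by blast
  then have "y = (\<Sum>i\<in>I. f i (w i))" unfolding s(1) by (intro sum.cong) auto
  then show thesis by (rule that)
qed

lemma sum_cocoercive_rectangular:
  fixes f :: "'i \<Rightarrow> 'a::real_inner \<Rightarrow> 'a"
  assumes fin: "finite I" and coc: "\<And>i. i \<in> I \<Longrightarrow> cocoercive (c i) (f i)"
    and pos: "\<And>i. i \<in> I \<Longrightarrow> c i > 0" and y: "y \<in> (\<Sum>i\<in>I. range (f i))"
  shows "\<exists>K. \<forall>x. x \<bullet> (y - (\<Sum>i\<in>I. f i x)) \<le> K"
proof -
  obtain w where w: "y = (\<Sum>i\<in>I. f i (w i))" using set_sum_rangeE[OF fin y] by blast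
  have "x \<bullet> (y - (\<Sum>i\<in>I. f i x)) \<le> (\<Sum>i\<in>I. (norm (w i))\<^sup>2 / (4 * c i))" for x
  proof -
    have "x \<bullet> (y - (\<Sum>i\<in>I. f i x)) = (\<Sum>i\<in>I. - (x \<bullet> (f i x - f i (w i))))"
      by (simp add: w inner_sum_right inner_diff_right sum_subtractf)
    also have "\<dots> \<le> (\<Sum>i\<in>I. (norm (w i))\<^sup>2 / (4 * c i))"
    proof (rule sum_mono)
      fix i assume "i \<in> I"
      then show "- (x \<bullet> (f i x - f i (w i))) \<le> (norm (w i))\<^sup>2 / (4 * c i)"
        using cocoercive_rectangular[of "c i" "f i" "w i" x] coc[of i] pos[of i] by linarith
    qed
    finally show ?thesis .
  qed
  then show ?thesis by blast
qed

section \<open>Tikhonov regularisation\<close>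

lemma rectangular_imp_in_closure_range:
  fixes F :: "'a::{real_inner, complete_space} \<Rightarrow> 'a"
  assumes mono: "\<And>x y. 0 \<le> (x - y) \<bullet> (F x - F y)"
    and cont: "continuous_on UNIV F" and K: "\<And>x. x \<bullet> (y - F x) \<le> K"
  shows "y \<in> closure (range F)"
proof -
  have K0: "0 \<le> K" using K[of 0] by simp
  have "\<exists>z\<in>range F. dist z y < d" if d: "0 < d" for d
  proof -
    \<comment> \<open>The residual satisfies \<open>\<parallel>y - F x\<parallel>\<^sup>2 \<le> e K\<close>, which this choice makes smaller than \<open>d\<^sup>2\<close>.\<close>
    define e where "e = d\<^sup>2 / (K + 1)"
    have e: "0 < e" using d K0 by (simp add: e_def)
    then obtain x where x: "e *\<^sub>R x + F x = y"
      using continuous_monotone_regularised_surj[OF mono cont] by blast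
    then have yx: "y - F x = e *\<^sub>R x" by (simp add: algebra_simps)
    have "(norm (y - F x))\<^sup>2 = e * (x \<bullet> (y - F x))"
      unfolding yx power2_norm_eq_inner by simp
    also have "\<dots> \<le> e * K" using K e by (intro mult_left_mono) auto
    also have "\<dots> < d\<^sup>2" using d K0 by (simp add: e_def field_simps)
    finally have "norm (y - F x) < d" using d by (simp add: power_less_imp_less_base)
    then show ?thesis by (metis dist_commute dist_norm rangeI)
  qed
  then show ?thesis by (simp add: closure_approachable)
qed

text \<open>
  As the regularisation parameter decreases, monotonicity makes the norms of the solutions
  increase and controls their distances by the increments of the squared norms.  Hence bounded
  solutions converge strongly, and no weak compactness is needed.
\<close>

lemma bounded_regularised_solutions_imp_in_range:
  fixes F :: "'a::{real_inner, complete_space} \<Rightarrow> 'a"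
  assumes mono: "\<And>x y. 0 \<le> (x - y) \<bullet> (F x - F y)"
    and cont: "continuous_on UNIV F"
    and x: "\<And>k. inverse (real (Suc k)) *\<^sub>R x k + F (x k) = y"
    and C: "\<And>k. norm (x k) \<le> C"
  shows "y \<in> range F"
proof -
  define N where "N k = (norm (x k))\<^sup>2" for k
  have key: "(norm (x l - x k))\<^sup>2 \<le> N l - N k" if "k \<le> l" for k l
  proof (cases "k = l")
    case False
    define e where "e = inverse (real (Suc k))"
    define d where "d = inverse (real (Suc l))"
    have d: "0 < d" "d < e" using that False by (auto simp: e_def d_def intro!: less_imp_inverse_less)
    have "F (x k) = y - e *\<^sub>R x k" "F (x l) = y - d *\<^sub>R x l"
      using x[of k] x[of l] unfolding e_def d_def by (metis add_diff_cancel_left')+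
    then have "F (x k) - F (x l) = d *\<^sub>R x l - e *\<^sub>R x k" by simp
    then have "0 \<le> (x k - x l) \<bullet> (d *\<^sub>R x l - e *\<^sub>R x k)"
      using mono[of "x k" "x l"] by simp
    also have "\<dots> = (e - d) / 2 * (N l - N k) - (e + d) / 2 * (norm (x l - x k))\<^sup>2"
      unfolding N_def power2_norm_eq_inner
      by (simp add: inner_commute[of "x k" "x l"] field_simps inner_diff_left inner_diff_right)
    finally have le: "(e + d) * (norm (x l - x k))\<^sup>2 \<le> (e - d) * (N l - N k)"
      by (simp add: field_simps)
    have "(e - d) * (norm (x l - x k))\<^sup>2 \<le> (e + d) * (norm (x l - x k))\<^sup>2"
      using d by (intro mult_right_mono) auto
    with le have "(e - d) * (norm (x l - x k))\<^sup>2 \<le> (e - d) * (N l - N k)" by linarith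
    then show ?thesis using d by simp
  qed simp
  have inc: "incseq N"
    by (rule incseq_SucI) (metis key le_SucI diff_ge_0_iff_ge order_refl order_trans zero_le_power2)
  have "N k \<le> C\<^sup>2" for k
    unfolding N_def using C by (intro power_mono) auto
  then obtain \<nu> where \<nu>: "N \<longlonglongrightarrow> \<nu>" "\<And>k. N k \<le> \<nu>"
    using incseq_convergent[OF inc] by blast
  have "Cauchy x"
    unfolding Cauchy_altdef2
  proof (intro allI impI)
    fix d :: real assume d: "0 < d"
    then have "\<forall>\<^sub>F k in sequentially. \<nu> - d\<^sup>2 < N k"
      using \<nu>(1) by (intro order_tendstoD) auto
    then obtain M where M: "\<nu> - d\<^sup>2 < N M" by (auto simp: eventually_sequentially)
    have "dist (x l) (x M) < d" if "M \<le> l" for l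
    proof -
      have "(norm (x l - x M))\<^sup>2 < d\<^sup>2" using key[OF that] \<nu>(2)[of l] M by linarith
      then show ?thesis using d by (simp add: dist_norm power_less_imp_less_base)
    qed
    then show "\<exists>M. \<forall>l\<ge>M. dist (x l) (x M) < d" by blast
  qed
  then obtain z where z: "x \<longlonglongrightarrow> z"
    using Cauchy_convergent convergent_def by blast
  have "isCont F z" using cont by (simp add: continuous_on_eq_continuous_at)
  then have "(\<lambda>k. F (x k)) \<longlonglongrightarrow> F z" using z by (rule isCont_tendsto_compose)
  then have "(\<lambda>k. inverse (real (Suc k)) *\<^sub>R x k + F (x k)) \<longlonglongrightarrow> 0 *\<^sub>R z + F z"
    using z LIMSEQ_inverse_real_of_nat by (intro tendsto_intros)
  then have "(\<lambda>k::nat. y) \<longlonglongrightarrow> F z" by (simp only: x scaleR_zero_left add_0)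
  then have "y = F z" by (simp add: LIMSEQ_const_iff)
  then show ?thesis by simp
qed

section \<open>Near equality and the range of a sum of cocoercive mappings\<close>

lemma closed_affine_hull_props:
  shows "affine (closed_affine_hull C)" "closed (closed_affine_hull C)" "C \<subseteq> closed_affine_hull C"
proof -
  have "affine (closed_affine_hull C) \<and> closed (closed_affine_hull C)"
    unfolding closed_affine_hull_def by (rule hull_in) (auto intro: affine_Inter)
  then show "affine (closed_affine_hull C)" "closed (closed_affine_hull C)" by auto
  show "C \<subseteq> closed_affine_hull C" unfolding closed_affine_hull_def by (rule hull_subset)
qed

lemma closed_affine_hull_closure: "closed_affine_hull (closure C) = closed_affine_hull C"
proof
  show "closed_affine_hull (closure C) \<subseteq> closed_affine_hull C"
    unfolding closed_affine_hull_def[of "closure C"]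
    by (rule hull_minimal) (simp_all add: closed_affine_hull_props closure_minimal)
  show "closed_affine_hull C \<subseteq> closed_affine_hull (closure C)"
    unfolding closed_affine_hull_def by (rule hull_mono) (rule closure_subset)
qed

text \<open>
  Equal closures give equal closed affine hulls, so both relative interiors are taken in the same
  space, where \<open>ri D\<close> is an open subset of \<open>C\<close>.
\<close>

lemma nearly_equalI:
  assumes "C \<subseteq> D" "D \<subseteq> closure C" "ri D \<subseteq> C"
  shows "C \<simeq> D"
proof -
  have cl: "closure C = closure D"
    using assms(1,2) by (metis closure_closure closure_mono subset_antisym)
  then have hull: "closed_affine_hull C = closed_affine_hull D"
    by (metis closed_affine_hull_closure)
  have "ri C = ri D"
  proof
    show "ri C \<subseteq> ri D"
      unfolding ri_def hull using assms(1) by (rule interior_of_mono)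
    show "ri D \<subseteq> ri C"
      using assms(3) unfolding ri_def hull by (simp add: interior_of_maximal)
  qed
  with cl show ?thesis by (simp add: nearly_equal_def)
qed

lemma riE:
  assumes "y \<in> ri D"
  obtains d where "d > 0" "\<And>v. v \<in> closed_affine_hull D \<Longrightarrow> dist y v < d \<Longrightarrow> v \<in> D" "y \<in> D"
proof -
  obtain T where T: "openin (top_of_set (closed_affine_hull D)) T" "y \<in> T" "T \<subseteq> D"
    using assms by (auto simp: ri_def interior_of_def)
  then obtain d where "d > 0" "ball y d \<inter> closed_affine_hull D \<subseteq> T"
    unfolding openin_contains_ball by blast
  then show thesis using T by (intro that[of d]) auto
qed

text \<open>
  The Brezis--Haraux argument.  Let \<open>x \<epsilon>\<close> solve \<open>\<epsilon> x + F x = y\<close>.  Rectangularity bounds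
  \<open>x \<epsilon> \<bullet> h\<close> whenever \<open>y + h\<close> lies in the Minkowski sum of the ranges; taking \<open>h = 0\<close> gives the
  closure.  If \<open>y\<close> is a relative interior point, this bounds \<open>x \<epsilon>\<close> pointwise on the closed
  direction space \<open>L\<close> of the hull.  Since \<open>x \<epsilon>\<close> itself belongs to \<open>L\<close>, it is bounded in norm.
\<close>

theorem range_sum_cocoercive_nearly_equal:
  fixes f :: "'i \<Rightarrow> 'a::{real_inner, complete_space} \<Rightarrow> 'a"
  assumes fin: "finite I" and coc: "\<And>i. i \<in> I \<Longrightarrow> cocoercive (c i) (f i)"
    and pos: "\<And>i. i \<in> I \<Longrightarrow> c i > 0"
  shows "range (\<lambda>x. \<Sum>i\<in>I. f i x) \<simeq> (\<Sum>i\<in>I. range (f i))"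
proof -
  define F where "F = (\<lambda>x. \<Sum>i\<in>I. f i x)"
  define D where "D = (\<Sum>i\<in>I. range (f i))"
  have mono: "0 \<le> (x - y) \<bullet> (F x - F y)" for x y
  proof -
    have "(x - y) \<bullet> (F x - F y) = (\<Sum>i\<in>I. (x - y) \<bullet> (f i x - f i y))"
      by (simp add: F_def inner_sum_right sum_subtractf[symmetric])
    also have "\<dots> \<ge> 0" using cocoercive_monotone coc pos by (intro sum_nonneg) blast
    finally show ?thesis .
  qed
  have cont: "continuous_on UNIV F"
    unfolding F_def using cocoercive_imp_continuous coc pos by (intro continuous_on_sum) blast
  have rect: "\<exists>K. \<forall>x. x \<bullet> (y - F x) \<le> K" if "y \<in> D" for y
    using sum_cocoercive_rectangular[OF fin coc pos] that by (simp add: F_def D_def)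
  have sub: "range F \<subseteq> D"
    unfolding D_def F_def using fin by (auto simp: set_sum_alt)
  have dense: "D \<subseteq> closure (range F)"
    using rectangular_imp_in_closure_range[OF mono cont] rect by blast
  have "ri D \<subseteq> range F"
  proof
    fix y assume "y \<in> ri D"
    then obtain d where d: "d > 0"
      and ballD: "\<And>v. v \<in> closed_affine_hull D \<Longrightarrow> dist y v < d \<Longrightarrow> v \<in> D" and yD: "y \<in> D"
      by (rule riE) blast
    define V where "V = closed_affine_hull D"
    have V: "affine V" "closed V" "D \<subseteq> V" unfolding V_def by (rule closed_affine_hull_props)+
    define L where "L = (\<lambda>v. v - y) ` V"
    have L_iff: "h \<in> L \<longleftrightarrow> y + h \<in> V" for h
      by (force simp: L_def image_iff)
    have L: "subspace L" "closed L"
    proof -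
      show "subspace L"
        unfolding L_def using V yD by (intro affine_diffs_subspace_subtract) auto
      have "L = (\<lambda>v. - y + v) ` V" by (simp add: L_def)
      then show "closed L" using V(2) closed_translation by metis
    qed
    have "\<exists>x. inverse (real (Suc k)) *\<^sub>R x + F x = y" for k
      by (rule continuous_monotone_regularised_surj[OF mono cont]) simp
    then obtain x where x: "\<And>k. inverse (real (Suc k)) *\<^sub>R x k + F (x k) = y" by metis
    have yF: "y - F (x k) = inverse (real (Suc k)) *\<^sub>R x k" for k
      using x[of k] by (simp add: algebra_simps)
    \<comment> \<open>\<open>x k\<close> is a multiple of the difference \<open>y - F (x k)\<close> of two points of \<open>V\<close>.\<close>
    have xL: "x k \<in> L" for k
    proof -
      have "F (x k) - y \<in> L" using sub V(3) by (auto simp: L_iff)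
      then have "(- real (Suc k)) *\<^sub>R (F (x k) - y) \<in> L" using L(1) subspace_scale by blast
      moreover have "(- real (Suc k)) *\<^sub>R (F (x k) - y) = real (Suc k) *\<^sub>R (y - F (x k))"
        by (simp add: algebra_simps)
      ultimately show ?thesis by (simp add: yF del: of_nat_Suc)
    qed
    have pw: "\<exists>K. \<forall>z\<in>range x. z \<bullet> h \<le> K" if h: "h \<in> L" for h
    proof -
      \<comment> \<open>Shrink \<open>h\<close> so that \<open>y + s h\<close> stays in the relative neighbourhood of \<open>y\<close> inside \<open>D\<close>.\<close>
      define s where "s = d / (norm h + 1)"
      have n1: "0 < norm h + 1" using norm_ge_zero[of h] by linarith
      have s: "0 < s" using d n1 by (simp add: s_def)
      have "norm (s *\<^sub>R h) < d" using d n1 by (simp add: s_def field_simps)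
      moreover have "s *\<^sub>R h \<in> L" using L(1) h by (rule subspace_scale)
      ultimately have "y + s *\<^sub>R h \<in> D"
        using ballD by (simp add: L_iff V_def dist_norm)
      then obtain K where K: "\<And>z. z \<bullet> (y + s *\<^sub>R h - F z) \<le> K" using rect by blast
      have "x k \<bullet> h \<le> K / s" for k
      proof -
        have "x k \<bullet> (y + s *\<^sub>R h - F (x k)) = x k \<bullet> (y - F (x k)) + s * (x k \<bullet> h)"
          by (simp add: algebra_simps)
        also have "x k \<bullet> (y - F (x k)) = inverse (real (Suc k)) * (x k \<bullet> x k)"
          unfolding yF by simp
        finally have "s * (x k \<bullet> h) \<le> K"
          using K[of "x k"] inner_ge_zero[of "x k"]
          by (smt (verit) inverse_nonnegative_iff_nonnegative mult_nonneg_nonneg of_nat_0_le_iff)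
        then show ?thesis using s by (simp add: field_simps)
      qed
      then show ?thesis by blast
    qed
    obtain C where "\<forall>z\<in>range x. norm z \<le> C"
      using pointwise_bounded_above_imp_norm_bounded[OF L(2,1) _ pw] xL by blast
    then show "y \<in> range F"
      using bounded_regularised_solutions_imp_in_range[OF mono cont x] by blast
  qed
  then have "range F \<simeq> D" by (rule nearly_equalI[OF sub dense])
  then show ?thesis by (simp add: F_def D_def)
qed

section \<open>Resolvents and the resolvent average\<close>

lemma resolvent_iff:
  "x \<in> svinv (svadd A (svscale c svid)) u \<longleftrightarrow> u - c *\<^sub>R x \<in> A x"
  for A :: "'a::real_vector svmap"
proof -
  have "u \<in> A x + {c *\<^sub>R x} \<longleftrightarrow> (\<exists>a\<in>A x. u = a + c *\<^sub>R x)"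
    by (auto simp: set_plus_def)
  also have "\<dots> \<longleftrightarrow> u - c *\<^sub>R x \<in> A x" by (force simp: algebra_simps)
  finally show ?thesis by (simp add: svinv_def svadd_def svscale_def svid_def)
qed

text \<open>
  The resolvent \<open>T = (A + c Id)\<^sup>-\<^sup>1\<close> is single-valued with full domain, and both \<open>T\<close> and its
  complement \<open>Id - c T\<close> are cocoercive; their ranges are the domain and the range of \<open>A\<close>.
\<close>

lemma maximally_monotone_resolvent:
  fixes A :: "'a::{real_inner, complete_space} svmap"
  assumes A: "maximally_monotone A" and c: "c > 0"
  obtains T where "\<And>u. svinv (svadd A (svscale c svid)) u = {T u}"
    and "cocoercive c T" and "cocoercive 1 (\<lambda>u. u - c *\<^sub>R T u)"
    and "range T = svdom A" and "range (\<lambda>u. u - c *\<^sub>R T u) = svran A"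
proof -
  note mm = maximally_monotoneD[OF A]
  have "\<exists>x. u - c *\<^sub>R x \<in> A x" for u by (rule minty[OF mm c])
  then obtain T where T: "\<And>u. u - c *\<^sub>R T u \<in> A (T u)" by metis
  have mono: "0 \<le> (x - y) \<bullet> ((u - c *\<^sub>R x) - (v - c *\<^sub>R y))"
    if "u - c *\<^sub>R x \<in> A x" "v - c *\<^sub>R y \<in> A y" for x y u v
    using mm(1) that unfolding monotone_map_def by blast
  have uniq: "x = T u" if "u - c *\<^sub>R x \<in> A x" for x u
  proof -
    have "0 \<le> - c * ((x - T u) \<bullet> (x - T u))"
      using mono[OF that T[of u]] by (simp add: algebra_simps)
    then have "(x - T u) \<bullet> (x - T u) \<le> 0" using c by (simp add: mult_le_0_iff)
    then show ?thesis by (metis inner_ge_zero inner_eq_zero_iff order_antisym eq_iff_diff_eq_0)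
  qed
  show thesis
  proof (rule that)
    show "svinv (svadd A (svscale c svid)) u = {T u}" for u
      using resolvent_iff[of _ A c u] T uniq by blast
    show "cocoercive c T"
      unfolding cocoercive_def power2_norm_eq_inner
      using mono[OF T T] by (simp add: algebra_simps inner_commute)
    show "cocoercive 1 (\<lambda>u. u - c *\<^sub>R T u)"
      unfolding cocoercive_def
    proof (intro allI)
      fix u v
      define q where "q = (u - c *\<^sub>R T u) - (v - c *\<^sub>R T v)"
      have "0 \<le> c * ((T u - T v) \<bullet> q)" using mono[OF T T, of u v] c by (simp add: q_def)
      also have "\<dots> = ((u - v) - q) \<bullet> q" by (simp add: q_def algebra_simps)
      finally show "1 * (norm ((u - c *\<^sub>R T u) - (v - c *\<^sub>R T v)))\<^sup>2
          \<le> (u - v) \<bullet> ((u - c *\<^sub>R T u) - (v - c *\<^sub>R T v))"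
        by (simp add: q_def[symmetric] power2_norm_eq_inner inner_diff_left)
    qed
    have TA: "T (a + c *\<^sub>R x) = x" if "a \<in> A x" for a x
      using uniq[of "a + c *\<^sub>R x" x] that by simp
    show "range T = svdom A"
    proof
      show "range T \<subseteq> svdom A" using T by (auto simp: svdom_def)
      show "svdom A \<subseteq> range T"
        using TA unfolding svdom_def by (metis (mono_tags, lifting) all_not_in_conv mem_Collect_eq rangeI subsetI)
    qed
    show "range (\<lambda>u. u - c *\<^sub>R T u) = svran A"
    proof
      show "range (\<lambda>u. u - c *\<^sub>R T u) \<subseteq> svran A" using T by (auto simp: svran_def)
      show "svran A \<subseteq> range (\<lambda>u. u - c *\<^sub>R T u)"
      proof
        fix a assume "a \<in> svran A"
        then obtain x where "a \<in> A x" by (auto simp: svran_def)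
        then have "a = (\<lambda>u. u - c *\<^sub>R T u) (a + c *\<^sub>R x)" using TA by simp
        then show "a \<in> range (\<lambda>u. u - c *\<^sub>R T u)" by (rule range_eqI)
      qed
    qed
  qed
qed

lemma set_sum_singletons: "(\<Sum>i\<in>I. {s i}) = {sum s I}" for s :: "'i \<Rightarrow> 'a::comm_monoid_add"
  by (induction I rule: infinite_finite_induct) (auto simp: set_plus_def set_zero)

lemma resolvent_average_eq:
  fixes A :: "'i \<Rightarrow> 'a::real_vector svmap"
  assumes "\<And>i u. i \<in> I \<Longrightarrow> svinv (svadd (A i) (svscale (inverse \<mu>) svid)) u = {T i u}"
  shows "resolvent_average \<mu> I A lam x
    = {u - inverse \<mu> *\<^sub>R x |u. x = (\<Sum>i\<in>I. lam i *\<^sub>R T i u)}"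
proof -
  have "svsum (\<lambda>i. svscale (lam i) (svinv (svadd (A i) (svscale (inverse \<mu>) svid)))) I u
      = {\<Sum>i\<in>I. lam i *\<^sub>R T i u}" for u
  proof -
    have "svsum (\<lambda>i. svscale (lam i) (svinv (svadd (A i) (svscale (inverse \<mu>) svid)))) I u
        = (\<Sum>i\<in>I. {lam i *\<^sub>R T i u})"
      unfolding svsum_def svscale_def[of "lam _"] using assms by (intro sum.cong) auto
    then show ?thesis by (simp add: set_sum_singletons)
  qed
  then show ?thesis
    unfolding resolvent_average_def
    by (auto simp: svadd_def svinv_def[of "svsum _ _"] svscale_def svid_def set_plus_def)
qed

theorem theorem2p11:
  fixes \<mu> :: real and n :: nat and lam :: "nat \<Rightarrow> real"
    and A :: "nat \<Rightarrow> 'a::{real_inner, complete_space} \<Rightarrow> 'a set"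
  assumes "\<mu> > 0" and "n \<ge> 1"
    and "\<And>i. i \<in> {1..n} \<Longrightarrow> lam i > 0"
    and "(\<Sum>i\<in>{1..n}. lam i) = 1"
    and "\<And>i. i \<in> {1..n} \<Longrightarrow> maximally_monotone (A i)"
  shows "svran (resolvent_average \<mu> {1..n} A lam) \<simeq> (\<Sum>i\<in>{1..n}. (*\<^sub>R) (lam i) ` svran (A i))
       \<and> svdom (resolvent_average \<mu> {1..n} A lam) \<simeq> (\<Sum>i\<in>{1..n}. (*\<^sub>R) (lam i) ` svdom (A i))"
proof -
  define c where "c = inverse \<mu>"
  have c: "c > 0" using assms(1) by (simp add: c_def)
  have "\<forall>i\<in>{1..n}. \<exists>T. (\<forall>u. svinv (svadd (A i) (svscale c svid)) u = {T u})
      \<and> cocoercive c T \<and> cocoercive 1 (\<lambda>u. u - c *\<^sub>R T u)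
      \<and> range T = svdom (A i) \<and> range (\<lambda>u. u - c *\<^sub>R T u) = svran (A i)"
    by (metis maximally_monotone_resolvent[OF assms(5) c])
  then obtain T where T: "\<And>i u. i \<in> {1..n} \<Longrightarrow> svinv (svadd (A i) (svscale c svid)) u = {T i u}"
    and coc: "\<And>i. i \<in> {1..n} \<Longrightarrow> cocoercive c (T i)"
    and coc': "\<And>i. i \<in> {1..n} \<Longrightarrow> cocoercive 1 (\<lambda>u. u - c *\<^sub>R T i u)"
    and dom: "\<And>i. i \<in> {1..n} \<Longrightarrow> range (T i) = svdom (A i)"
    and ran: "\<And>i. i \<in> {1..n} \<Longrightarrow> range (\<lambda>u. u - c *\<^sub>R T i u) = svran (A i)"
    unfolding bchoice_iff by blast
  define J where "J u = (\<Sum>i\<in>{1..n}. lam i *\<^sub>R T i u)" for u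
  have R: "resolvent_average \<mu> {1..n} A lam x = {u - c *\<^sub>R x |u. x = J u}" for x
    using resolvent_average_eq[of "{1..n}" A \<mu> T lam x] T by (simp add: c_def J_def)
  have domR: "svdom (resolvent_average \<mu> {1..n} A lam) = range J"
    unfolding svdom_def R by auto
  have "svran (resolvent_average \<mu> {1..n} A lam) = range (\<lambda>u. u - c *\<^sub>R J u)"
    unfolding svran_def R by auto
  also have "(\<lambda>u. u - c *\<^sub>R J u) = (\<lambda>u. \<Sum>i\<in>{1..n}. lam i *\<^sub>R (u - c *\<^sub>R T i u))"
    using assms(4)
    by (simp add: J_def fun_eq_iff scaleR_diff_right sum_subtractf scaleR_sum_right
        scaleR_sum_left[symmetric] mult.commute)
  finally have ranR: "svran (resolvent_average \<mu> {1..n} A lam)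
      = range (\<lambda>u. \<Sum>i\<in>{1..n}. lam i *\<^sub>R (u - c *\<^sub>R T i u))" .
  have "range (\<lambda>u. \<Sum>i\<in>{1..n}. lam i *\<^sub>R (u - c *\<^sub>R T i u))
      \<simeq> (\<Sum>i\<in>{1..n}. range (\<lambda>u. lam i *\<^sub>R (u - c *\<^sub>R T i u)))"
    by (rule range_sum_cocoercive_nearly_equal[where c = "\<lambda>i. 1 / lam i"])
      (use assms(3) cocoercive_scaleR[OF coc'] in auto)
  also have "(\<Sum>i\<in>{1..n}. range (\<lambda>u. lam i *\<^sub>R (u - c *\<^sub>R T i u)))
      = (\<Sum>i\<in>{1..n}. (*\<^sub>R) (lam i) ` svran (A i))"
    by (intro sum.cong) (simp_all add: ran[symmetric] image_image)
  finally have 1: "svran (resolvent_average \<mu> {1..n} A lam)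
      \<simeq> (\<Sum>i\<in>{1..n}. (*\<^sub>R) (lam i) ` svran (A i))" by (simp only: ranR)
  have "range J \<simeq> (\<Sum>i\<in>{1..n}. range (\<lambda>u. lam i *\<^sub>R T i u))"
    unfolding J_def
    by (rule range_sum_cocoercive_nearly_equal[where c = "\<lambda>i. c / lam i"])
      (use assms(3) c cocoercive_scaleR[OF coc] in auto)
  also have "(\<Sum>i\<in>{1..n}. range (\<lambda>u. lam i *\<^sub>R T i u)) = (\<Sum>i\<in>{1..n}. (*\<^sub>R) (lam i) ` svdom (A i))"
    by (intro sum.cong) (simp_all add: dom[symmetric] image_image)
  finally have "svdom (resolvent_average \<mu> {1..n} A lam)
      \<simeq> (\<Sum>i\<in>{1..n}. (*\<^sub>R) (lam i) ` svdom (A i))" by (simp only: domR)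
  with 1 show ?thesis ..
qed

end
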